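(* (a) Let $\varepsilon>0$ and $\delta\ge 0$. If a channel $Q$ is $(\varepsilon,\delta)$-differentially private, then $Q$ is $(\varepsilon_{\mathsf{CH}},\delta_{\mathsf{CH}})$-conditional hypothesis testing private (CHTP), where $$\varepsilon_{\mathsf{CH}}=(1+e^{-\varepsilon})(1-e^{-2\varepsilon})\le 4\varepsilon \quad\text{and}\quad \delta_{\mathsf{CH}}=(e^{2\varepsilon}-e^{\varepsilon})^{-1}\delta\le \varepsilon^{-1}\delta .$$ (b) Conversely, let $0\le \varepsilon_{\mathsf{CH}}<1$ and $\delta_{\mathsf{CH}}\ge 0$, and let $Q$ be a channel such that every channel $Q'\preceq Q$ is $(\varepsilon_{\mathsf{CH}},\delta_{\mathsf{CH}})$-CHTP. Then $Q$ is $(\varepsilon,\delta)$-differentially private with $$\varepsilon=2\log\left(\frac{1+\varepsilon_{\mathsf{CH}}}{1-\varepsilon_{\mathsf{CH}}}\right)\le\frac{4\varepsilon_{\mathsf{CH}}}{1-\varepsilon_{\mathsf{CH}}}\quad\text{and}\quad \delta=\delta_{\mathsf{CH}}\cdot\frac{1+\varepsilon_{\mathsf{CH}}}{1-\varepsilon_{\mathsf{CH}}}.$$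
   Context: Let $\mathcal X$ be a measurable space and $n\ge 1$. For a measurable space $\mathcal Y$, a channel $Q$ from $\mathcal X^n$ to $\mathcal Y$ is a Markov kernel: $Q(\cdot\mid x_{1:n})$ is a probability distribution on $\mathcal Y$ for each $x_{1:n}=(x_1,\dots,x_n)\in\mathcal X^n$, measurable in $x_{1:n}$. Write $d_{\rm ham}(x_{1:n},x'_{1:n})$ for the number of indices $i$ with $x_i\ne x_i'$. Differential privacy: $Q$ is $(\varepsilon,\delta)$-(approximately) differentially private if for all $x_{1:n},x'_{1:n}$ with $d_{\rm ham}(x_{1:n},x'_{1:n})\le 1$ and all measurable $A\subset\mathcal Y$, $Q(A\mid x_{1:n})\le e^{\varepsilon}Q(A\mid x'_{1:n})+\delta$. CHTP: $Q$ is $(\varepsilon,\delta)$-conditional hypothesis testing private if for any $x_{1:n},x'_{1:n}$ with $d_{\rm ham}(x_{1:n},x'_{1:n})\le 1$, any measurable $A\subset\mathcal Y$ with $\min\{Q(A\mid x_{1:n}),Q(A\mid x'_{1:n})\}\ge\delta$ (and with both probabilities positive, so that the conditional channels below are defined), and any measurable test $\psi:\mathcal Y\to\{0,1\}$, $$Q(\psi=1\mid x_{1:n};A)+Q(\psi=0\mid x'_{1:n};A)\ge 1-\varepsilon,$$ where $Q(B\mid x_{1:n};A)=Q(B\cap A\mid x_{1:n})/Q(A\mid x_{1:n})$, and $Q(\psi=j\mid x_{1:n};A)$ means $Q(\{y:\psi(y)=j\}\mid x_{1:n};A)$. Order on channels: for a channel $Q$ from $\mathcal X^n$ to $\mathcal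 Y$ and a channel $Q'$ from $\mathcal X^n$ to a measurable space $\mathcal Z$ (possibly different from $\mathcal Y$), write $Q'\preceq Q$ ("$Q'$ is less informative than $Q$") if there is a Markov kernel $Q''$ from $\mathcal Y$ to $\mathcal Z$ with $Q'(A\mid x_{1:n})=\int Q''(A\mid y)\,dQ(y\mid x_{1:n})$ for all measurable $A\subset\mathcal Z$ and all $x_{1:n}$. *)

theory Defs
  imports "HOL-Probability.Probability"
begin

abbreviation sample_space :: "nat \<Rightarrow> 'x measure \<Rightarrow> (nat \<Rightarrow> 'x) measure"
  where "sample_space n X \<equiv> (\<Pi>\<^sub>M i\<in>{..<n}. X)"

text \<open>
  Only the \<open>\<sigma>\<close>-algebras of \<open>X\<close>, \<open>Y\<close>, \<open>Z\<close> matter below: these measures stand for measurable spaces.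
\<close>

definition markov_kernel :: "'a measure \<Rightarrow> 'b measure \<Rightarrow> ('a \<Rightarrow> 'b measure) \<Rightarrow> bool"
  where "markov_kernel S T K \<longleftrightarrow> K \<in> S \<rightarrow>\<^sub>M prob_algebra T"

definition channel :: "nat \<Rightarrow> 'x measure \<Rightarrow> 'y measure \<Rightarrow> ((nat \<Rightarrow> 'x) \<Rightarrow> 'y measure) \<Rightarrow> bool"
  where "channel n X Y Q \<longleftrightarrow> markov_kernel (sample_space n X) Y Q"

definition d_ham :: "nat \<Rightarrow> (nat \<Rightarrow> 'x) \<Rightarrow> (nat \<Rightarrow> 'x) \<Rightarrow> nat"
  where "d_ham n x x' = card {i. i < n \<and> x i \<noteq> x' i}"

definition differentially_private ::
    "nat \<Rightarrow> 'x measure \<Rightarrow> 'y measure \<Rightarrow> ((nat \<Rightarrow> 'x) \<Rightarrow> 'y measure) \<Rightarrow> real \<Rightarrow> real \<Rightarrow> bool"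
  where "differentially_private n X Y Q \<epsilon> \<delta> \<longleftrightarrow>
    (\<forall>x\<in>space (sample_space n X). \<forall>x'\<in>space (sample_space n X). d_ham n x x' \<le> 1 \<longrightarrow>
      (\<forall>A\<in>sets Y. measure (Q x) A \<le> exp \<epsilon> * measure (Q x') A + \<delta>))"

definition cond_measure :: "'y measure \<Rightarrow> 'y set \<Rightarrow> 'y set \<Rightarrow> real"
  where "cond_measure P B A = measure P (B \<inter> A) / measure P A"

definition CHTP ::
    "nat \<Rightarrow> 'x measure \<Rightarrow> 'y measure \<Rightarrow> ((nat \<Rightarrow> 'x) \<Rightarrow> 'y measure) \<Rightarrow> real \<Rightarrow> real \<Rightarrow> bool"
  where "CHTP n X Y Q \<epsilon> \<delta> \<longleftrightarrow>
    (\<forall>x\<in>space (sample_space n X). \<forall>x'\<in>space (sample_space n X). d_ham n x x' \<le> 1 \<longrightarrow>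
      (\<forall>A\<in>sets Y. \<forall>\<psi> \<in> Y \<rightarrow>\<^sub>M count_space {0, 1::nat}.
        0 < measure (Q x) A \<and> 0 < measure (Q x') A \<and>
        min (measure (Q x) A) (measure (Q x') A) \<ge> \<delta> \<longrightarrow>
        cond_measure (Q x) {y \<in> space Y. \<psi> y = 1} A +
        cond_measure (Q x') {y \<in> space Y. \<psi> y = 0} A \<ge> 1 - \<epsilon>))"

text \<open>
  \<open>less_informative n X Z Q' Y Q\<close>: the channel \<open>Q'\<close> into \<open>Z\<close> is obtained from the channel \<open>Q\<close>
  into \<open>Y\<close> by post-processing with a Markov kernel from \<open>Y\<close> to \<open>Z\<close>.
\<close>

definition less_informative ::
    "nat \<Rightarrow> 'x measure \<Rightarrow> 'z measure \<Rightarrow> ((nat \<Rightarrow> 'x) \<Rightarrow> 'z measure) \<Rightarrow>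
      'y measure \<Rightarrow> ((nat \<Rightarrow> 'x) \<Rightarrow> 'y measure) \<Rightarrow> bool"
  where "less_informative n X Z Q' Y Q \<longleftrightarrow>
    (\<exists>K. markov_kernel Y Z K \<and>
      (\<forall>A\<in>sets Z. \<forall>x\<in>space (sample_space n X).
        measure (Q' x) A = (\<integral>y. measure (K y) A \<partial>Q x)))"

end

theory Submission
  imports Defs
begin

text \<open>
  Write \<open>P\<close>, \<open>P'\<close> for the output laws on two neighbouring samples.

  (a) With \<open>t = exp \<epsilon>\<close> and \<open>z = 1/t\<close>, the assumption on \<open>A\<close> turns the additive slack \<open>\<delta>\<close> of
  differential privacy into the multiple \<open>t\<^sup>2 - t\<close> of \<open>P A\<close> and \<open>P' A\<close>, so that
  \<open>P A \<le> t\<^sup>2 P' A\<close>. Bounding \<open>P (B \<inter> A)\<close> below by \<open>z (P' (B \<inter> A) - \<delta>)\<close>, the gap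
  \<open>P' (B | A) - P (B | A)\<close> is extremal at \<open>P' (B | A) = 1\<close> and \<open>P' A = z\<^sup>2 P A\<close>.

  (b) Put \<open>k = (1 + \<epsilon>\<^sub>C\<^sub>H) / (1 - \<epsilon>\<^sub>C\<^sub>H)\<close> and suppose \<open>P A > k\<^sup>2 P' A + k \<delta>\<close>. Report a point \<open>u\<close> on \<open>A\<close>;
  off \<open>A\<close> report \<open>v\<close> with probability \<open>c\<close> and a third point otherwise. Conditionally on \<open>{u, v}\<close> the
  law of this report puts mass more than \<open>k / (k + 1)\<close> on \<open>u\<close> under \<open>P\<close> and at most \<open>1 / (k + 1)\<close>
  under \<open>P'\<close>, if \<open>c (1 - P' A)\<close> is slightly above \<open>k P' A + \<delta>\<close>; when that is too large, \<open>c = 1\<close> works.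
  The difference exceeds \<open>(k - 1) / (k + 1) = \<epsilon>\<^sub>C\<^sub>H\<close>.
\<close>

section \<open>From differential privacy to conditional testing\<close>

text \<open>Numerical core of (a): \<open>p\<close>, \<open>p'\<close> are the masses of
  \<open>A\<close>, and \<open>a\<close>, \<open>a'\<close> those of its part where the test is 1.
  Privacy enters in both directions: once to keep \<open>p'\<close> from being small against
  \<open>p\<close>, once to keep \<open>a\<close> from being small against
  \<open>a'\<close>.\<close>

lemma conditional_gap_le:
  fixes t \<delta> p p' a a' :: real
  assumes t: "t > 1" and p: "p > 0" "p' > 0" and a: "0 \<le> a" "0 \<le> a'" "a' \<le> p'"
    and dp: "p \<le> t * p' + \<delta>" "a' \<le> t * a + \<delta>"
    and \<delta>: "\<delta> \<le> (t\<^sup>2 - t) * p" "\<delta> \<le> (t\<^sup>2 - t) * p'"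
  shows "a' / p' - a / p \<le> (1 + 1 / t) * (1 - 1 / t\<^sup>2)"
proof -
  define z where "z = 1 / t"
  define r s v d where "r = a' / p'" and "s = a / p" and "v = p' / p" and "d = \<delta> / p"
  have z: "z > 0" "z < 1" "z * t = 1"
    using t by (auto simp: z_def)
  have r: "0 \<le> r" "r \<le> 1" and s: "0 \<le> s" and v: "v > 0"
    using a p by (auto simp: r_def s_def v_def)
  have test: "r * v \<le> t * s + d"
    using dp(2) p by (simp add: r_def s_def v_def d_def field_simps)
  have mass: "1 \<le> t * v + d"
    using dp(1) p by (simp add: v_def d_def field_simps)
  have d: "d \<le> t\<^sup>2 - t" "d \<le> (t\<^sup>2 - t) * v"
    using \<delta> p by (simp_all add: v_def d_def field_simps)
  \<comment> \<open>The second bound is the sharper one for \<open>v \<le> 1\<close>, the first for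
    larger \<open>v\<close>; the inner case split follows this.\<close>
  have zd: "z * d \<le> t - 1" "z * d \<le> (t - 1) * v"
  proof -
    have eq: "z * (t\<^sup>2 - t) = t - 1"
      using z(3) by algebra
    show "z * d \<le> t - 1"
      using mult_left_mono[OF d(1), of z] z eq by simp
    show "z * d \<le> (t - 1) * v"
      using mult_left_mono[OF d(2), of z] z eq by (simp flip: mult.assoc)
  qed
  have "z * (r * v) \<le> z * (t * s + d)"
    using test z by simp
  also have "\<dots> = s + z * d"
    using z(3) by algebra
  finally have gap: "r - s \<le> r - z * (r * v) + z * d"
    by simp
  have "r - s \<le> (1 + z) * (1 - z\<^sup>2)"
  \<comment> \<open>The claimed bound equals \<open>1 + z * (1 - z - z\<^sup>2)\<close>, which is at
    least 1 in this case, while \<open>r - s \<le> 1\<close> always.\<close>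
  proof (cases "t\<^sup>2 - t \<ge> 1")
    case True
    then have "z\<^sup>2 * (t\<^sup>2 - t) \<ge> z\<^sup>2 * 1"
      by (intro mult_left_mono) auto
    moreover have "z\<^sup>2 * (t\<^sup>2 - t) = 1 - z"
      using z(3) by algebra
    ultimately have "z * (1 - z - z\<^sup>2) \<ge> 0"
      using z by simp
    then show ?thesis
      using r s by (simp add: algebra_simps power2_eq_square)
  next
    case False
    have "z * (t\<^sup>2 - t) \<le> z * 1"
      using False z by (intro mult_left_mono) auto
    moreover have "z * (t\<^sup>2 - t) = t - 1"
      using z(3) by algebra
    ultimately have tz: "t \<le> 1 + z"
      by simp
    show ?thesis
    proof (cases "v \<le> 1")
      case True
      have "z\<^sup>2 * 1 \<le> z\<^sup>2 * (t\<^sup>2 * v)"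
        using mass d(2) by (intro mult_left_mono) (auto simp: algebra_simps)
      also have "\<dots> = v"
        using z(3) by algebra
      finally have v_ge: "z\<^sup>2 \<le> v"
        by simp
      have "r * (1 - z * v) \<le> 1 * (1 - z * v)"
        using r z True v by (intro mult_right_mono) (auto intro: mult_le_one)
      then have "r - s \<le> 1 - v * (z + 1 - t)"
        using gap zd(2) by (simp add: algebra_simps)
      \<comment> \<open>By \<open>tz\<close> the expression does not increase with \<open>v\<close>,
        so the smallest admissible \<open>v\<close> is the worst.\<close>
      also have "\<dots> \<le> 1 - z\<^sup>2 * (z + 1 - t)"
        using v_ge tz by (intro diff_left_mono mult_right_mono) auto
      also have "\<dots> = (1 + z) * (1 - z\<^sup>2)"
        using z(3) by algebra
      finally show ?thesis .
    next
      case False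
      have "z * (r * 1) \<le> z * (r * v)"
        using False r z by (intro mult_left_mono) auto
      moreover have "r * (1 - z) \<le> 1 * (1 - z)"
        using r z by (intro mult_right_mono) auto
      ultimately have "r - s \<le> t - z"
        using gap zd(1) by (simp add: algebra_simps)
      also have "\<dots> = t * (1 - z\<^sup>2)"
        using z(3) by algebra
      also have "\<dots> \<le> (1 + z) * (1 - z\<^sup>2)"
        using tz z by (intro mult_right_mono) (auto simp: power_le_one)
      finally show ?thesis .
    qed
  qed
  then show ?thesis
    by (simp add: r_def s_def z_def power_divide)
qed

lemma channelD:
  assumes "channel n X Y Q" "x \<in> space (sample_space n X)"
  shows "prob_space (Q x)" "sets (Q x) = sets Y"
proof -
  have "Q x \<in> space (prob_algebra Y)"
    using assms by (auto simp: channel_def markov_kernel_def dest: measurable_space)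
  then show "prob_space (Q x)" "sets (Q x) = sets Y"
    by (auto simp: space_prob_algebra)
qed

lemma d_ham_commute: "d_ham n x x' = d_ham n x' x"
  unfolding d_ham_def by (rule arg_cong[of _ _ card]) auto

text \<open>Since \<open>B0\<close> and \<open>B1\<close> split \<open>A\<close>, the error sum is 1
  minus the gap between the conditional masses of \<open>B1\<close> under \<open>x'\<close> and
  \<open>x\<close>, so \<open>conditional_gap_le\<close> applies.\<close>

lemma differentially_private_imp_CHTP:
  assumes ch: "channel n X Y Q" and \<epsilon>: "\<epsilon> > 0"
    and dp: "differentially_private n X Y Q \<epsilon> \<delta>"
  shows "CHTP n X Y Q ((1 + exp (- \<epsilon>)) * (1 - exp (- 2 * \<epsilon>)))
           (inverse (exp (2 * \<epsilon>) - exp \<epsilon>) * \<delta>)"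
  unfolding CHTP_def
proof (intro ballI impI)
  fix x x' A and \<psi> :: "'b \<Rightarrow> nat"
  assume x: "x \<in> space (sample_space n X)" and x': "x' \<in> space (sample_space n X)"
    and nb: "d_ham n x x' \<le> 1" and A: "A \<in> sets Y"
    and \<psi>: "\<psi> \<in> Y \<rightarrow>\<^sub>M count_space {0, 1}"
    and pos: "0 < measure (Q x) A \<and> 0 < measure (Q x') A \<and>
      inverse (exp (2 * \<epsilon>) - exp \<epsilon>) * \<delta> \<le> min (measure (Q x) A) (measure (Q x') A)"
  define B0 B1 where "B0 = {y \<in> space Y. \<psi> y = 0}" and "B1 = {y \<in> space Y. \<psi> y = 1}"
  have B: "B0 \<in> sets Y" "B1 \<in> sets Y"
    using measurable_sets[OF \<psi>, of "{0}"] measurable_sets[OF \<psi>, of "{1}"]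
    by (auto simp: B0_def B1_def vimage_def Int_def conj_commute)
  have "\<psi> y = 0 \<or> \<psi> y = 1" if "y \<in> space Y" for y
    using measurable_space[OF \<psi> that] by simp
  then have split: "A = (B1 \<inter> A) \<union> (B0 \<inter> A)"
    using sets.sets_into_space[OF A] unfolding B0_def B1_def by blast
  interpret P: prob_space "Q x" by (rule channelD[OF ch x])
  interpret P': prob_space "Q x'" by (rule channelD[OF ch x'])
  have sets_Q: "sets (Q x) = sets Y" "sets (Q x') = sets Y"
    by (rule channelD(2)[OF ch x], rule channelD(2)[OF ch x'])
  have sum': "measure (Q x') A = measure (Q x') (B1 \<inter> A) + measure (Q x') (B0 \<inter> A)"
    using A B by (subst split, subst P'.finite_measure_Union) (auto simp: sets_Q B0_def B1_def)
  define t where "t = exp \<epsilon>"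
  have t: "t > 1" and t2: "exp (2 * \<epsilon>) = t\<^sup>2"
    using \<epsilon> by (auto simp: t_def power2_eq_square simp flip: exp_add)
  have tt: "t\<^sup>2 - t > 0"
    using t by (simp add: power2_eq_square)
  have "measure (Q x') (B1 \<inter> A) / measure (Q x') A - measure (Q x) (B1 \<inter> A) / measure (Q x) A
      \<le> (1 + 1 / t) * (1 - 1 / t\<^sup>2)"
  proof (rule conditional_gap_le[where \<delta> = \<delta>])
    show "measure (Q x') (B1 \<inter> A) \<le> measure (Q x') A"
      using sum' by simp
    show "measure (Q x) A \<le> t * measure (Q x') A + \<delta>"
      using dp x x' nb A by (auto simp: differentially_private_def t_def)
    show "measure (Q x') (B1 \<inter> A) \<le> t * measure (Q x) (B1 \<inter> A) + \<delta>"
      using dp x x' nb A B by (auto simp: differentially_private_def t_def d_ham_commute)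
    show "\<delta> \<le> (t\<^sup>2 - t) * measure (Q x) A" "\<delta> \<le> (t\<^sup>2 - t) * measure (Q x') A"
      using pos tt unfolding t2 t_def[symmetric] by (simp_all add: inverse_eq_divide divide_le_eq mult.commute)
  qed (use t pos in auto)
  moreover have "1 / t = exp (- \<epsilon>)" "1 / t\<^sup>2 = exp (- 2 * \<epsilon>)"
    using t2 by (auto simp: t_def exp_minus field_simps)
  moreover have "measure (Q x') (B0 \<inter> A) / measure (Q x') A =
      1 - measure (Q x') (B1 \<inter> A) / measure (Q x') A"
    using sum' pos by (simp add: field_simps)
  ultimately show "cond_measure (Q x) {y \<in> space Y. \<psi> y = 1} A +
        cond_measure (Q x') {y \<in> space Y. \<psi> y = 0} A
      \<ge> 1 - (1 + exp (- \<epsilon>)) * (1 - exp (- 2 * \<epsilon>))"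
    unfolding cond_measure_def B0_def[symmetric] B1_def[symmetric] by simp
qed

lemma CH_epsilon_le:
  fixes \<epsilon> :: real
  assumes "\<epsilon> > 0"
  shows "(1 + exp (- \<epsilon>)) * (1 - exp (- 2 * \<epsilon>)) \<le> 4 * \<epsilon>"
proof -
  have "(1 + exp (- \<epsilon>)) * (1 - exp (- 2 * \<epsilon>)) \<le> 2 * (2 * \<epsilon>)"
    using assms exp_ge_add_one_self[of "- 2 * \<epsilon>"] by (intro mult_mono) auto
  then show ?thesis by simp
qed

lemma CH_delta_le:
  fixes \<epsilon> \<delta> :: real
  assumes "\<epsilon> > 0" "\<delta> \<ge> 0"
  shows "inverse (exp (2 * \<epsilon>) - exp \<epsilon>) * \<delta> \<le> inverse \<epsilon> * \<delta>"
proof -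
  have "1 * \<epsilon> \<le> exp \<epsilon> * (exp \<epsilon> - 1)"
    using assms exp_ge_add_one_self[of \<epsilon>]
    by (intro mult_mono) (simp_all del: exp_ge_add_one_self)
  also have "\<dots> = exp (2 * \<epsilon>) - exp \<epsilon>"
    by (simp add: algebra_simps flip: exp_add)
  finally show ?thesis
    using assms by (intro mult_right_mono le_imp_inverse_le) auto
qed

section \<open>From conditional testing to differential privacy\<close>

text \<open>With a pmf as output law every set of reports is an event, so neither the conditioning
  set nor the test raises a measurability question.\<close>

definition thinning :: "'y set \<Rightarrow> real \<Rightarrow> 'z \<Rightarrow> 'z \<Rightarrow> 'z \<Rightarrow> 'y \<Rightarrow> 'z measure"
  where "thinning A c u v w y = measure_pmf
    (if y \<in> A then return_pmf u else map_pmf (\<lambda>b. if b then v else w) (bernoulli_pmf c))"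

lemma markov_kernel_thinning:
  assumes "A \<in> sets Y"
  shows "markov_kernel Y (count_space UNIV) (thinning A c u v w)"
  unfolding markov_kernel_def thinning_def if_distrib[of measure_pmf]
  using assms
  by (intro measurable_If_set measurable_const)
     (auto simp: space_prob_algebra measure_pmf.prob_space_axioms)

lemma measure_bind_thinning:
  assumes "prob_space P" "sets P = sets Y" "A \<in> sets Y"
  shows "measure (P \<bind> thinning A c u v w) S =
      measure P A * indicator S u +
      (1 - measure P A) * measure (map_pmf (\<lambda>b. if b then v else w) (bernoulli_pmf c)) S"
proof -
  interpret P: prob_space P by fact
  have K: "thinning A c u v w \<in> P \<rightarrow>\<^sub>M prob_algebra (count_space UNIV)"
    using markov_kernel_thinning[OF assms(3)] assms(2)
    by (simp add: markov_kernel_def cong: measurable_cong_sets)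
  define m where "m = measure (map_pmf (\<lambda>b. if b then v else w) (bernoulli_pmf c)) S"
  have "measure (P \<bind> thinning A c u v w) S = (\<integral>y. measure (thinning A c u v w y) S \<partial>P)"
    by (rule P.measure_bind[OF measurable_prob_algebraD[OF K]]) auto
  \<comment> \<open>The integrand takes one value on \<open>A\<close> and one off \<open>A\<close>;
    written as an affine function of the indicator, its integral depends only on the mass of
    \<open>A\<close>.\<close>
  also have "\<dots> = (\<integral>y. m + indicator A y * (indicator S u - m) \<partial>P)"
    by (intro Bochner_Integration.integral_cong)
       (auto simp: thinning_def m_def measure_return_pmf)
  also have "\<dots> = m + measure P A * (indicator S u - m)"
  proof -
    have "A \<in> P.events"
      using assms by simp
    then show ?thesis
      by (subst Bochner_Integration.integral_add)
         (auto simp: P.prob_space P.emeasure_eq_measure intro!: integrable_mult_left integrable_real_indicator)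
  qed
  finally show ?thesis
    by (simp add: m_def algebra_simps)
qed

lemma channel_bind:
  assumes "channel n X Y Q" "markov_kernel Y Z K"
  shows "channel n X Z (\<lambda>x. Q x \<bind> K)"
  using assms unfolding channel_def markov_kernel_def
  by (intro measurable_bind_prob_space)

lemma less_informative_bind:
  assumes ch: "channel n X Y Q" and K: "markov_kernel Y Z K"
  shows "less_informative n X Z (\<lambda>x. Q x \<bind> K) Y Q"
  unfolding less_informative_def
proof (intro exI[of _ K] conjI K ballI)
  fix A x assume A: "A \<in> sets Z" and x: "x \<in> space (sample_space n X)"
  interpret prob_space "Q x" by (rule channelD[OF ch x])
  have "K \<in> Q x \<rightarrow>\<^sub>M prob_algebra Z"
    using K channelD(2)[OF ch x] by (simp add: markov_kernel_def cong: measurable_cong_sets)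
  then show "measure (Q x \<bind> K) A = (\<integral>y. measure (K y) A \<partial>Q x)"
    using A by (intro measure_bind[OF measurable_prob_algebraD])
qed

text \<open>Turns the testing hypothesis into an inequality between numbers:
  \<open>p + (1 - p) * c\<close> is the mass of the conditioning event \<open>{u, v}\<close>, and
  the quotients are the conditional masses of \<open>u\<close>.\<close>

lemma CHTP_thinning:
  fixes u v w :: 'z
  assumes ch: "channel n X Y Q" and A: "A \<in> sets Y"
    and x: "x \<in> space (sample_space n X)" and x': "x' \<in> space (sample_space n X)"
    and nb: "d_ham n x x' \<le> 1"
    and chtp: "\<And>Q'. channel n X (count_space (UNIV :: 'z set)) Q' \<Longrightarrow>
      less_informative n X (count_space UNIV) Q' Y Q \<Longrightarrow> CHTP n X (count_space UNIV) Q' \<epsilon> \<delta>"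
    and uvw: "u \<noteq> v" "u \<noteq> w" "v \<noteq> w"
    and c: "0 \<le> c" "c \<le> 1"
    and p: "p = measure (Q x) A" "p' = measure (Q x') A"
    and ge: "p + (1 - p) * c \<ge> \<delta>" "p' + (1 - p') * c \<ge> \<delta>"
    and pos: "p + (1 - p) * c > 0" "p' + (1 - p') * c > 0"
  shows "p / (p + (1 - p) * c) - p' / (p' + (1 - p') * c) \<le> \<epsilon>"
proof -
  define K where "K = thinning A c u v w"
  \<comment> \<open>The test decides for \<open>x\<close> exactly at \<open>u\<close>. Given
    \<open>{u, v}\<close>, its error under \<open>x\<close> is the mass of \<open>v\<close>, and its
    error under \<open>x'\<close> is the mass of \<open>u\<close>.\<close>
  define \<psi> :: "'z \<Rightarrow> nat" where "\<psi> = (\<lambda>z. if z = u then 0 else 1)"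
  have K: "markov_kernel Y (count_space UNIV) K"
    unfolding K_def by (rule markov_kernel_thinning[OF A])
  have *: "CHTP n X (count_space UNIV) (\<lambda>x. Q x \<bind> K) \<epsilon> \<delta>"
    using channel_bind[OF ch K] less_informative_bind[OF ch K] by (rule chtp)
  have meas: "measure (Q x \<bind> K) S = measure (Q x) A * indicator S u +
      (1 - measure (Q x) A) * (c * indicator S v + (1 - c) * indicator S w)"
    if "x \<in> space (sample_space n X)" for x S
  proof -
    have "measure (bernoulli_pmf c) T = c * indicator T True + (1 - c) * indicator T False" for T
    proof -
      have "T \<in> {{}, {True}, {False}, {True, False}}"
        using Pow_UNIV[where 'a = bool] by (auto simp: UNIV_bool Pow_insert)
      then show ?thesis
        using c by (auto simp: measure_pmf_single measure_measure_pmf_finite)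
    qed
    then show ?thesis
      using measure_bind_thinning[OF channelD(1,2)[OF ch that] A, of c u v w S]
      by (simp add: K_def indicator_def)
  qed
  have \<psi>: "\<psi> \<in> count_space UNIV \<rightarrow>\<^sub>M count_space {0, 1}"
    by (auto simp: \<psi>_def)
  have W: "measure (Q x \<bind> K) {u, v} = p + (1 - p) * c"
    "measure (Q x' \<bind> K) {u, v} = p' + (1 - p') * c"
    using x x' uvw by (simp_all add: meas p)
  have S: "{y. \<psi> y = 1} \<inter> {u, v} = {v}" "{y. \<psi> y = 0} \<inter> {u, v} = {u}"
    using uvw by (auto simp: \<psi>_def)
  have "cond_measure (Q x \<bind> K) {y \<in> space (count_space UNIV). \<psi> y = 1} {u, v} +
      cond_measure (Q x' \<bind> K) {y \<in> space (count_space UNIV). \<psi> y = 0} {u, v} \<ge> 1 - \<epsilon>"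
    using *[unfolded CHTP_def] x x' nb \<psi> pos ge by (auto simp del: One_nat_def simp: W)
  moreover have "cond_measure (Q x \<bind> K) {y \<in> space (count_space UNIV). \<psi> y = 1} {u, v} =
      (1 - p) * c / (p + (1 - p) * c)"
    "cond_measure (Q x' \<bind> K) {y \<in> space (count_space UNIV). \<psi> y = 0} {u, v} =
      p' / (p' + (1 - p') * c)"
    using x x' uvw by (simp_all add: cond_measure_def W S[simplified] meas p)
  moreover have "(1 - p) * c / (p + (1 - p) * c) = 1 - p / (p + (1 - p) * c)"
    using pos by (simp add: field_simps)
  ultimately show ?thesis
    by simp
qed

lemma exists_thinning_gap:
  fixes k p p' \<delta> :: real
  assumes k: "k \<ge> 1" and p: "p \<le> 1" "0 \<le> p'" and \<delta>: "\<delta> \<ge> 0"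
    and gt: "p > k\<^sup>2 * p' + \<delta> * k"
  obtains c where "0 \<le> c" "c \<le> 1"
    "p + (1 - p) * c \<ge> \<delta>" "p' + (1 - p') * c \<ge> \<delta>"
    "p + (1 - p) * c > 0" "p' + (1 - p') * c > 0"
    "p / (p + (1 - p) * c) - p' / (p' + (1 - p') * c) > (k - 1) / (k + 1)"
proof -
  have gt': "p > k * (k * p' + \<delta>)"
    using gt by (simp add: power2_eq_square algebra_simps)
  have kp: "p' \<le> k * p'"
    using mult_right_mono[OF k p(2)] by simp
  then have "k * p' + \<delta> \<le> k * (k * p' + \<delta>)"
    using mult_right_mono[OF k, of "k * p' + \<delta>"] p \<delta> by simp
  then have "k * p' + \<delta> < p"
    using gt' by (rule le_less_trans)
  with kp have p_gt: "k * p' + \<delta> < p" "p' < p" "\<delta> < p" "p' \<le> k * p'"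
    using p \<delta> by linarith+
  have p_pos: "p > 0" "p' < 1"
    using p_gt p by linarith+
  show ?thesis
  proof (cases "k * p' + \<delta> < 1 - p'")
    case True
    have "k * p' + \<delta> < p / k"
      using gt' k by (simp add: field_simps)
    \<comment> \<open>\<open>C\<close> is to be the mass of \<open>v\<close> under the second law.
      The lower bound makes \<open>u\<close> rare there and \<open>{u, v}\<close> heavy enough;
      \<open>p / k\<close> keeps \<open>u\<close> dominant under the first law;
      \<open>1 - p'\<close> allows \<open>c \<le> 1\<close>.\<close>
    then obtain C where C: "k * p' + \<delta> < C" "C < p / k" "C < 1 - p'"
      using True dense[of "k * p' + \<delta>" "min (p / k) (1 - p')"] by auto
    define c where "c = C / (1 - p')"
    have C_pos: "C > 0"
      using C(1) k p \<delta> p_gt by linarith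
    have c: "0 \<le> c" "c \<le> 1" "(1 - p') * c = C"
      using C C_pos p_pos by (auto simp: c_def)
    \<comment> \<open>The same \<open>c\<close> puts no more mass on \<open>v\<close> under the
      first law, because \<open>p' < p\<close>.\<close>
    have "(1 - p) * c \<le> (1 - p') * c"
      using p_gt c by (intro mult_right_mono) auto
    then have pc: "(1 - p) * c \<le> C" "0 \<le> (1 - p) * c"
      using c p by auto
    have "k * C < p"
      using C k by (simp add: field_simps)
    then have "k / (k + 1) < p / (p + C)"
      using k p_pos C_pos by (simp add: field_simps)
    also have "\<dots> \<le> p / (p + (1 - p) * c)"
      using p_pos pc by (intro divide_left_mono) (auto intro!: mult_pos_pos)
    finally have 1: "k / (k + 1) < p / (p + (1 - p) * c)" .
    have 2: "p' / (p' + (1 - p') * c) \<le> 1 / (k + 1)"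
      using C \<delta> p k C_pos c(3) by (simp add: field_simps)
    have "(k - 1) / (k + 1) = k / (k + 1) - 1 / (k + 1)"
      by (simp add: diff_divide_distrib)
    then have "p / (p + (1 - p) * c) - p' / (p' + (1 - p') * c) > (k - 1) / (k + 1)"
      using 1 2 by linarith
    moreover have "\<delta> \<le> C"
      using C p p_gt by linarith
    ultimately show ?thesis
      using that[of c] c pc p p_pos p_gt C_pos by auto
  next
    case False
    \<comment> \<open>With \<open>c = 1\<close> both denominators are 1 and the gap is
      \<open>p - p'\<close>. Adding \<open>k - 1\<close> times the second estimate to the first
      cancels \<open>p'\<close>.\<close>
    have 1: "p - p' > (k\<^sup>2 - 1) * p' + \<delta> * k"
      using gt by (simp add: algebra_simps)
    have "k * (k * p' + \<delta>) \<ge> k * (1 - p')"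
      using False k by (intro mult_left_mono) auto
    then have 2: "p - p' > k - (k + 1) * p'"
      using gt' by (simp add: algebra_simps)
    have "(k - 1) * (p - p') \<ge> (k - 1) * (k - (k + 1) * p')"
      using 2 k by (intro mult_left_mono) auto
    moreover have "0 \<le> \<delta> * k"
      using \<delta> k by simp
    ultimately have "k * (p - p') > k * (k - 1)"
      using 1 by (simp add: algebra_simps power2_eq_square)
    then have "p - p' > k - 1"
      using k by simp
    moreover have "(k - 1) / (k + 1) \<le> k - 1"
      using divide_left_mono[of 1 "k + 1" "k - 1"] k by simp
    ultimately show ?thesis
      using that[of 1] p p_gt by auto
  qed
qed

lemma CHTP_imp_differentially_private:
  fixes e :: "real \<Rightarrow> 'z"
  assumes ch: "channel n X Y Q" and e: "inj e" and \<epsilon>: "0 \<le> \<epsilon>" "\<epsilon> < 1" and \<delta>: "\<delta> \<ge> 0"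
    and chtp: "\<And>Q'. channel n X (count_space (UNIV :: 'z set)) Q' \<Longrightarrow>
      less_informative n X (count_space UNIV) Q' Y Q \<Longrightarrow> CHTP n X (count_space UNIV) Q' \<epsilon> \<delta>"
  shows "differentially_private n X Y Q
    (2 * ln ((1 + \<epsilon>) / (1 - \<epsilon>))) (\<delta> * ((1 + \<epsilon>) / (1 - \<epsilon>)))"
  unfolding differentially_private_def
proof (intro ballI impI, rule ccontr)
  fix x x' A
  assume x: "x \<in> space (sample_space n X)" and x': "x' \<in> space (sample_space n X)"
    and nb: "d_ham n x x' \<le> 1" and A: "A \<in> sets Y"
    and contr: "\<not> measure (Q x) A \<le>
      exp (2 * ln ((1 + \<epsilon>) / (1 - \<epsilon>))) * measure (Q x') A + \<delta> * ((1 + \<epsilon>) / (1 - \<epsilon>))"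
  \<comment> \<open>This \<open>k\<close> solves \<open>(k - 1) / (k + 1) = \<epsilon>\<close>, so
    the gap produced by thinning contradicts the testing bound exactly.\<close>
  define k where "k = (1 + \<epsilon>) / (1 - \<epsilon>)"
  have k: "k \<ge> 1" "(k - 1) / (k + 1) = \<epsilon>"
    using \<epsilon> by (auto simp: k_def field_simps)
  have "exp (2 * ln k) = k\<^sup>2"
    using k by (simp add: exp_double)
  then have gt: "measure (Q x) A > k\<^sup>2 * measure (Q x') A + \<delta> * k"
    using contr by (simp add: k_def)
  have "measure (Q x) A \<le> 1"
    by (rule prob_space.prob_le_1[OF channelD(1)[OF ch x]])
  from exists_thinning_gap[OF k(1) this measure_nonneg \<delta> gt]
  obtain c where c: "0 \<le> c" "c \<le> 1"
    "measure (Q x) A + (1 - measure (Q x) A) * c \<ge> \<delta>"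
    "measure (Q x') A + (1 - measure (Q x') A) * c \<ge> \<delta>"
    "measure (Q x) A + (1 - measure (Q x) A) * c > 0"
    "measure (Q x') A + (1 - measure (Q x') A) * c > 0"
    "measure (Q x) A / (measure (Q x) A + (1 - measure (Q x) A) * c) -
      measure (Q x') A / (measure (Q x') A + (1 - measure (Q x') A) * c) > (k - 1) / (k + 1)" .
  \<comment> \<open>Three values of \<open>e\<close> serve as the distinct reports \<open>u\<close>,
    \<open>v\<close>, \<open>w\<close>.\<close>
  have "e 0 \<noteq> e 1" "e 0 \<noteq> e 2" "e 1 \<noteq> e 2"
    using e by (auto simp: inj_eq)
  from CHTP_thinning[OF ch A x x' nb chtp this c(1,2) refl refl c(3-6)]
  show False
    using c(7) k(2) by simp
qed

lemma DP_epsilon_le: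
  fixes \<epsilon> :: real
  assumes "0 \<le> \<epsilon>" "\<epsilon> < 1"
  shows "2 * ln ((1 + \<epsilon>) / (1 - \<epsilon>)) \<le> 4 * \<epsilon> / (1 - \<epsilon>)"
proof -
  have "ln ((1 + \<epsilon>) / (1 - \<epsilon>)) \<le> (1 + \<epsilon>) / (1 - \<epsilon>) - 1"
    using assms by (intro ln_le_minus_one) auto
  also have "\<dots> = 2 * \<epsilon> / (1 - \<epsilon>)"
    using assms by (simp add: field_simps)
  finally show ?thesis
    by simp
qed

(* HOL cannot quantify over types inside a formula, so in the second part the measurable spaces Z
   range over those carried by a type 'z. The theorem holds for every 'z large enough to carry
   copies of all spaces over 'y and over 'y * real (outputs of Q with extra randomness). *)

theorem theorem1:
  fixes X :: "'x measure" and Y :: "'y measure"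
    and Q :: "(nat \<Rightarrow> 'x) \<Rightarrow> 'y measure" and n :: nat
  assumes "n \<ge> 1" and "channel n X Y Q"
  shows
    "(\<forall>\<epsilon> \<delta> :: real. \<epsilon> > 0 \<and> \<delta> \<ge> 0 \<longrightarrow>
       (let \<epsilon>\<^sub>C\<^sub>H = (1 + exp (- \<epsilon>)) * (1 - exp (- 2 * \<epsilon>));
            \<delta>\<^sub>C\<^sub>H = inverse (exp (2 * \<epsilon>) - exp \<epsilon>) * \<delta>
        in (differentially_private n X Y Q \<epsilon> \<delta> \<longrightarrow> CHTP n X Y Q \<epsilon>\<^sub>C\<^sub>H \<delta>\<^sub>C\<^sub>H) \<and>
           \<epsilon>\<^sub>C\<^sub>H \<le> 4 * \<epsilon> \<and> \<delta>\<^sub>C\<^sub>H \<le> inverse \<epsilon> * \<delta>)) \<and>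
     (\<forall>\<epsilon>\<^sub>C\<^sub>H \<delta>\<^sub>C\<^sub>H :: real. 0 \<le> \<epsilon>\<^sub>C\<^sub>H \<and> \<epsilon>\<^sub>C\<^sub>H < 1 \<and> \<delta>\<^sub>C\<^sub>H \<ge> 0 \<longrightarrow>
       (let \<epsilon> = 2 * ln ((1 + \<epsilon>\<^sub>C\<^sub>H) / (1 - \<epsilon>\<^sub>C\<^sub>H));
            \<delta> = \<delta>\<^sub>C\<^sub>H * ((1 + \<epsilon>\<^sub>C\<^sub>H) / (1 - \<epsilon>\<^sub>C\<^sub>H))
        in ((\<exists>e :: 'y \<times> real \<Rightarrow> 'z. inj e) \<and>
            (\<forall>(Z :: 'z measure) Q'. channel n X Z Q' \<and> less_informative n X Z Q' Y Q \<longrightarrow>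
               CHTP n X Z Q' \<epsilon>\<^sub>C\<^sub>H \<delta>\<^sub>C\<^sub>H)
            \<longrightarrow> differentially_private n X Y Q \<epsilon> \<delta>) \<and>
           \<epsilon> \<le> 4 * \<epsilon>\<^sub>C\<^sub>H / (1 - \<epsilon>\<^sub>C\<^sub>H)))"
proof (intro conjI allI impI, goal_cases)
  case (1 \<epsilon> \<delta>)
  then show ?case
    using differentially_private_imp_CHTP[OF assms(2)] CH_epsilon_le CH_delta_le
    by (simp add: Let_def)
next
  case (2 \<epsilon> \<delta>)
  have "differentially_private n X Y Q
      (2 * ln ((1 + \<epsilon>) / (1 - \<epsilon>))) (\<delta> * ((1 + \<epsilon>) / (1 - \<epsilon>)))"
    if e: "inj (e :: 'y \<times> real \<Rightarrow> 'z)"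
      and chtp: "\<And>(Z :: 'z measure) Q'.
        channel n X Z Q' \<and> less_informative n X Z Q' Y Q \<Longrightarrow> CHTP n X Z Q' \<epsilon> \<delta>" for e
  proof (rule CHTP_imp_differentially_private[OF assms(2)])
    \<comment> \<open>Fixing the first coordinate at an arbitrary point leaves an injection of the
      reals into the report type.\<close>
    show "inj (\<lambda>r. e (undefined, r))"
      using e by (auto simp: inj_def)
  qed (use 2 chtp in auto)
  then show ?case
    using 2 DP_epsilon_le by (auto simp: Let_def)
qed

end
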